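(* Let $f_1,\dots,f_m$ be Lipschitz maps of $\mathbb{R}^d$, let $\overline p=(p_1,\dots,p_m)$ be a probability vector, and suppose that the iterated function system $\Phi=(\{f_i\},\overline p)$ contracts on average, with Lyapunov exponent $\chi(\Phi)<0$. Let $\mu$ be the stationary measure of $\Phi$, let $\theta$ be the growth rate of the semigroup generated by $\{f_1,\dots,f_m\}$, and let $H_\mu$ be the entropy of the random walk on this semigroup with probabilities $p_1,\dots,p_m$. Then $$\dim_H(\mu)\le -\frac{H_\mu\log\theta}{\chi(\Phi)}.$$
   Context: Setting. $f_1,\dots,f_m:\mathbb{R}^d\to\mathbb{R}^d$ are Lipschitz maps, $\overline p=(p_1,\dots,p_m)$ is a probability vector, $\Omega=\prod_0^\infty\{1,\dots,m\}$, and $\nu$ is the product (Bernoulli) probability measure on $\Omega$ induced by $\overline p$. For a Lipschitz map $g$ of $\mathbb{R}^d$, $\|g\|$ denotes its Lipschitz constant. Contraction on average. $\Phi$ contracts on average if there is a real number $\chi(\Phi)<0$ (the Lyapunov exponent) such that for $\nu$-a.e. $\omega\in\Omega$, $$\lim_{n\to\infty}\tfrac1n\log\|f_{\omega_0}\circ\dots\circ f_{\omega_{n-1}}\|=\chi(\Phi).$$ Stationary measure. Under contraction on average, for $\nu$-a.e. $\omega$ the limit $\phi(\omega)=\lim_{n\to\infty}f_{\omega_0}\circ\dots\circ f_{\omega_{n-1}}(x_0)$ exists and does not depend on $x_0\in\mathbb{R}^d$; $\mu=\nu\circ\phi^{-1}$ is the unique stationary Borel probability measure on $\mathbb{R}^d$,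 i.e. $\mu(B)=\sum_{i=1}^m p_i\,\mu(f_i^{-1}B)$ for all Borel $B$. Growth rate. Two words in $\prod_0^{n-1}\{1,\dots,m\}$ are equivalent, $(\omega_0,\dots,\omega_{n-1})\sim(\omega'_0,\dots,\omega'_{n-1})$, if $f_{\omega_0}\circ\dots\circ f_{\omega_{n-1}}=f_{\omega'_0}\circ\dots\circ f_{\omega'_{n-1}}$. $D_n$ is the set of equivalence classes, and $\theta=\lim_{n\to\infty}\sqrt[n]{\#D_n}\in[1,m]$ (the limit exists by submultiplicativity). Entropy. For a class $c\in D_n$ let $\mu_n(c)=\sum p_{\omega_0}\cdots p_{\omega_{n-1}}$, the sum being over all words $(\omega_0,\dots,\omega_{n-1})$ in $c$. Let $H_n=-\sum_{c\in D_n}\mu_n(c)\log\mu_n(c)$ (with $0\log0=0$). If $\theta>1$, $H_\mu:=\lim_{n\to\infty}\frac{H_n}{n\log\theta}$ (the limit exists); if $\theta=1$, $H_\mu:=0$. Hausdorff dimension of a measure. $\dim_H(\mu)=\mu\text{-}\operatorname{ess\,sup}_x\ \liminf_{r\to0}\frac{\log\mu(B(x,r))}{\log r}$, where $B(x,r)$ is the ball of radius $r$ about $x$. *)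

theory Defs
  imports "HOL-Probability.Probability"
begin

text \<open>
  The index set \<open>{1,\<dots>,m}\<close> of the maps is the finite type \<open>'m\<close>, and a probability vector
  on it is a term of type \<open>'m pmf\<close> (weights \<open>0\<close> are allowed).  Since \<open>ln 0 = 0\<close> for reals,
  the logarithm of a possibly vanishing quantity is taken in the extended reals.
\<close>

definition elog :: "real \<Rightarrow> ereal" where
  "elog x = (if x = 0 then - \<infinity> else ereal (ln x))"

definition lipschitz_map :: "('a::metric_space \<Rightarrow> 'a) \<Rightarrow> bool" where
  "lipschitz_map g \<longleftrightarrow> (\<exists>L. L-lipschitz_on UNIV g)"

definition lipschitz_const :: "('a::metric_space \<Rightarrow> 'a) \<Rightarrow> real" where
  "lipschitz_const g = Inf {L. L-lipschitz_on UNIV g}"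

primrec word_map :: "('m \<Rightarrow> 'a \<Rightarrow> 'a) \<Rightarrow> 'm list \<Rightarrow> 'a \<Rightarrow> 'a" where
  "word_map f [] = id"
| "word_map f (i # w) = f i \<circ> word_map f w"

definition bernoulli_measure :: "'m pmf \<Rightarrow> (nat \<Rightarrow> 'm) measure" where
  "bernoulli_measure p = Pi\<^sub>M UNIV (\<lambda>_. measure_pmf p)"

definition contracts_on_average ::
    "'m pmf \<Rightarrow> ('m \<Rightarrow> 'a::metric_space \<Rightarrow> 'a) \<Rightarrow> real \<Rightarrow> bool" where
  "contracts_on_average p f chi \<longleftrightarrow>
     chi < 0 \<and>
     (AE \<omega> in bernoulli_measure p.
        (\<lambda>n. elog (lipschitz_const (word_map f (map \<omega> [0..<n]))) / ereal (real n))
          \<longlonglongrightarrow> ereal chi)"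

definition stationary_measure ::
    "'m::finite pmf \<Rightarrow> ('m \<Rightarrow> 'a::metric_space \<Rightarrow> 'a) \<Rightarrow> 'a measure \<Rightarrow> bool" where
  "stationary_measure p f \<mu> \<longleftrightarrow>
     prob_space \<mu> \<and> sets \<mu> = sets borel \<and>
     (\<forall>B\<in>sets borel. measure \<mu> B = (\<Sum>i\<in>UNIV. pmf p i * measure \<mu> (f i -` B)))"

definition words :: "nat \<Rightarrow> 'm list set" where
  "words n = {w. length w = n}"

definition word_equiv :: "('m \<Rightarrow> 'a \<Rightarrow> 'a) \<Rightarrow> nat \<Rightarrow> ('m list \<times> 'm list) set" where
  "word_equiv f n = {(u, v). u \<in> words n \<and> v \<in> words n \<and> word_map f u = word_map f v}"

definition word_classes :: "('m \<Rightarrow> 'a \<Rightarrow> 'a) \<Rightarrow> nat \<Rightarrow> 'm list set set" where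
  "word_classes f n = words n // word_equiv f n"

definition growth_rate :: "('m \<Rightarrow> 'a \<Rightarrow> 'a) \<Rightarrow> real" where
  "growth_rate f = lim (\<lambda>n. root n (real (card (word_classes f n))))"

definition class_prob :: "'m pmf \<Rightarrow> 'm list set \<Rightarrow> real" where
  "class_prob p c = (\<Sum>w\<in>c. prod_list (map (pmf p) w))"

definition class_entropy :: "'m pmf \<Rightarrow> ('m \<Rightarrow> 'a \<Rightarrow> 'a) \<Rightarrow> nat \<Rightarrow> real" where
  "class_entropy p f n = - (\<Sum>c\<in>word_classes f n. class_prob p c * ln (class_prob p c))"

definition walk_entropy :: "'m pmf \<Rightarrow> ('m \<Rightarrow> 'a \<Rightarrow> 'a) \<Rightarrow> real" where
  "walk_entropy p f =
     (if growth_rate f > 1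
      then lim (\<lambda>n. class_entropy p f n / (real n * ln (growth_rate f)))
      else 0)"

definition lower_local_dim :: "'a::metric_space measure \<Rightarrow> 'a \<Rightarrow> ereal" where
  "lower_local_dim \<mu> x =
     Liminf (at_right 0) (\<lambda>r. elog (measure \<mu> (ball x r)) / ereal (ln r))"

definition measure_hausdorff_dim :: "'a::metric_space measure \<Rightarrow> ereal" where
  "measure_hausdorff_dim \<mu> = esssup \<mu> (lower_local_dim \<mu>)"

end

theory Submission
  imports Defs
begin

text \<open>
  Iterating stationarity, \<open>\<mu> = \<Sum> P(w) (f\<^sub>w)\<^sub>* \<mu>\<close> over the words \<open>w\<close> of length \<open>n\<close>. Call \<open>w\<close> good if
  \<open>f\<^sub>w\<close> has Lipschitz constant below \<open>exp (n a)\<close> and its class has probability at least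
  \<open>exp (- n b)\<close>, where \<open>a > \<chi>\<close> and \<open>b > h = lim H\<^sub>n / n\<close>. If \<open>w\<close> is good and \<open>K\<close> is a ball carrying
  almost all of \<open>\<mu>\<close>, then each point of \<open>f\<^sub>w K\<close> is the centre of a ball of radius about \<open>exp (n a)\<close>
  containing \<open>f\<^sub>v K = f\<^sub>w K\<close> for all \<open>v\<close> in the class of \<open>w\<close>, so that ball has measure at least about
  \<open>exp (- n b)\<close>. Since only a lower limit over radii is at stake, it is enough that good words have
  probability tending to \<open>1\<close> along some sequence of lengths. For the Lipschitz constants this is
  contraction on average. For the class probabilities choose \<open>N\<close> with \<open>H\<^sub>N / N < b\<close>: the class of
  a concatenation of \<open>k\<close> words of length \<open>N\<close> has at least the product of the class probabilities,
  and the weak law of large numbers applies to its logarithm.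
\<close>

section \<open>Entropy and growth of the word semigroup\<close>

text \<open>Fekete's lemma. For fixed \<open>N\<close>, writing \<open>n = q * N + r\<close> with
  \<open>r < N\<close> bounds \<open>a n / n\<close> by \<open>a N / N\<close> plus a bounded
  remainder over \<open>n\<close>. Nonnegativity bounds the infimum from below and lets
  \<open>q\<close> be replaced by \<open>n / N\<close>.\<close>

lemma subadditive_nonneg_LIMSEQ:
  fixes a :: "nat \<Rightarrow> real"
  assumes sub: "\<And>m n. a (m + n) \<le> a m + a n" and nonneg: "\<And>n. 0 \<le> a n"
  shows "(\<lambda>n. a n / real n) \<longlonglongrightarrow> (INF n\<in>{1..}. a n / real n)"
proof -
  define L where "L = (INF n\<in>{1..}. a n / real n)"
  have bdd: "bdd_below ((\<lambda>n. a n / real n) ` {1..})"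
    by (rule bdd_belowI2[of _ 0]) (simp add: nonneg)
  have low: "L \<le> a n / real n" if "n \<ge> 1" for n
    unfolding L_def using that by (intro cINF_lower[OF bdd]) auto
  have up: "\<forall>\<^sub>F n in sequentially. a n / real n < y" if y: "L < y" for y
  proof -
    obtain N where N: "N \<ge> 1" "a N / real N < y"
      using y unfolding L_def by (subst (asm) cINF_less_iff[OF _ bdd]) auto
    have mult: "a (q * N + r) \<le> real q * a N + a r" for q r
    proof (induction q)
      case (Suc q)
      have "a (Suc q * N + r) \<le> a N + a (q * N + r)"
        using sub[of N "q * N + r"] by (simp add: add.assoc)
      then show ?case using Suc by (simp add: algebra_simps)
    qed simp
    define C where "C = Max (a ` {..N})"
    have C: "a r \<le> C" if "r \<le> N" for r
      unfolding C_def using that by (intro Max_ge) auto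
    have bound: "a n / real n \<le> a N / real N + C / real n" if "n \<ge> 1" for n
    proof -
      have "a n \<le> real (n div N) * a N + a (n mod N)"
        using mult[of "n div N" "n mod N"] by simp
      also have "a (n mod N) \<le> C"
        using N by (intro C) (simp add: less_imp_le)
      also have "real (n div N) * a N \<le> real n / real N * a N"
        by (intro mult_right_mono nonneg) (rule of_nat_div_le_of_nat)
      finally show ?thesis
        using that N by (simp add: field_simps)
    qed
    have "(\<lambda>n. a N / real N + C / real n) \<longlonglongrightarrow> a N / real N + 0"
      by (intro tendsto_intros lim_const_over_n)
    then have "\<forall>\<^sub>F n in sequentially. a N / real N + C / real n < y"
      using N(2) by (auto dest: order_tendstoD(2))
    then show ?thesis
      using eventually_ge_at_top[of 1]
      by eventually_elim (use bound in force)
  qed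
  have "(\<lambda>n. a n / real n) \<longlonglongrightarrow> L"
  proof (rule order_tendstoI)
    fix y assume "y < L"
    then show "\<forall>\<^sub>F n in sequentially. y < a n / real n"
      by (intro eventually_mono[OF eventually_ge_at_top[of 1]]) (use low in force)
  qed (rule up)
  then show ?thesis unfolding L_def .
qed

section \<open>Expectations over random words of fixed length\<close>

definition word_prob :: "'m pmf \<Rightarrow> 'm list \<Rightarrow> real" where
  "word_prob p w = prod_list (map (pmf p) w)"

text \<open>For a finite alphabet this is the expectation under the law of the first
  \<open>n\<close> letters of a Bernoulli sequence, kept as a finite sum;
  \<open>prefix_event_bernoulli_measure\<close> links it to the infinite product.\<close>

definition word_expectation :: "'m pmf \<Rightarrow> nat \<Rightarrow> ('m list \<Rightarrow> real) \<Rightarrow> real" where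
  "word_expectation p n g = (\<Sum>w\<in>words n. word_prob p w * g w)"

lemma finite_words [simp]: "finite (words n :: 'm::finite list set)"
  using finite_lists_length_eq[of "UNIV :: 'm set" n] by (simp add: words_def)

lemma word_prob_nonneg [simp]: "0 \<le> word_prob p w"
  by (induction w) (auto simp: word_prob_def)

lemma word_prob_append: "word_prob p (u @ v) = word_prob p u * word_prob p v"
  by (simp add: word_prob_def)

lemma sum_words_add:
  fixes g :: "'m::finite list \<Rightarrow> 'b::comm_monoid_add"
  shows "(\<Sum>w\<in>words (n + l). g w) = (\<Sum>u\<in>words n. \<Sum>v\<in>words l. g (u @ v))"
proof -
  have "bij_betw (\<lambda>(u, v). u @ v) (words n \<times> words l) (words (n + l) :: 'm list set)"
    by (rule bij_betw_byWitness[where f' = "\<lambda>w. (take n w, drop n w)"]) (auto simp: words_def)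
  then have "(\<Sum>w\<in>words (n + l). g w) = (\<Sum>(u, v)\<in>words n \<times> words l. g (u @ v))"
    by (subst sum.reindex_bij_betw[symmetric]) (auto simp: case_prod_unfold)
  then show ?thesis
    by (simp add: sum.cartesian_product)
qed

text \<open>Fubini for finite sums: the first \<open>n\<close> letters and the following
  \<open>l\<close> letters are independent.\<close>

lemma word_expectation_add:
  fixes p :: "'m::finite pmf"
  shows "word_expectation p (n + l) g =
    word_expectation p n (\<lambda>u. word_expectation p l (\<lambda>v. g (u @ v)))"
  by (simp add: word_expectation_def sum_words_add word_prob_append sum_distrib_left mult.assoc)

lemma word_expectation_plus:
  "word_expectation p n (\<lambda>w. g w + h w) = word_expectation p n g + word_expectation p n h"
  by (simp add: word_expectation_def algebra_simps sum.distrib)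

lemma word_expectation_cmult:
  "word_expectation p n (\<lambda>w. c * g w) = c * word_expectation p n g"
  by (simp add: word_expectation_def sum_distrib_left mult_ac)

lemma word_expectation_1:
  fixes p :: "'m pmf"
  shows "word_expectation p 1 g = (\<Sum>i\<in>UNIV. pmf p i * g [i])"
proof -
  have inj: "inj_on (\<lambda>i. [i]) (UNIV :: 'm set)" by (simp add: inj_on_def)
  have "words 1 = (\<lambda>i. [i]) ` (UNIV :: 'm set)"
    by (auto simp: words_def length_Suc_conv)
  then show ?thesis
    by (simp only: word_expectation_def sum.reindex[OF inj]) (simp add: word_prob_def)
qed

lemma word_expectation_const:
  fixes p :: "'m::finite pmf"
  shows "word_expectation p n (\<lambda>_. c) = c"
proof (induction n)
  case 0
  then show ?case by (simp add: word_expectation_def words_def word_prob_def)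
next
  case (Suc n)
  have "word_expectation p 1 (\<lambda>_. c) = (\<Sum>i\<in>UNIV. pmf p i) * c"
    by (simp only: word_expectation_1 sum_distrib_right)
  also have "(\<Sum>i\<in>UNIV. pmf p i) = 1" by (rule sum_pmf_eq_1) auto
  finally show ?case
    using word_expectation_add[of p 1 n "\<lambda>_. c"] Suc by simp
qed

text \<open>Words of probability zero carry no weight. Comparing only on the others keeps the class
  probabilities below positive and their logarithms meaningful.\<close>

lemma word_expectation_mono:
  "(\<And>w. w \<in> words n \<Longrightarrow> 0 < word_prob p w \<Longrightarrow> g w \<le> h w) \<Longrightarrow>
    word_expectation p n g \<le> word_expectation p n h"
  unfolding word_expectation_def
  by (intro sum_mono) (metis mult_left_mono mult_zero_left order.order_iff_strict word_prob_nonneg)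

lemma word_expectation_cong:
  assumes "\<And>w. w \<in> words n \<Longrightarrow> 0 < word_prob p w \<Longrightarrow> g w = h w"
  shows "word_expectation p n g = word_expectation p n h"
  using assms by (intro antisym word_expectation_mono) auto

text \<open>\<open>\<mu>\<^sub>n\<close> of the class of the word \<open>w\<close> of length \<open>n\<close>.\<close>

definition fibre_prob :: "'m pmf \<Rightarrow> ('m \<Rightarrow> 'a \<Rightarrow> 'a) \<Rightarrow> 'm list \<Rightarrow> real" where
  "fibre_prob p f w = class_prob p (word_equiv f (length w) `` {w})"

lemma fibre_prob_eq:
  "fibre_prob p f w =
    (\<Sum>v | v \<in> words (length w) \<and> word_map f v = word_map f w. word_prob p v)"
  unfolding fibre_prob_def class_prob_def word_prob_def
  by (rule sum.cong) (auto simp: word_equiv_def words_def)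

lemma fibre_prob_nonneg [simp]: "0 \<le> fibre_prob p f w"
  by (simp add: fibre_prob_eq sum_nonneg)

lemma word_prob_le_fibre_prob: "word_prob p w \<le> fibre_prob p f w"
  for p :: "'m::finite pmf"
  unfolding fibre_prob_eq by (rule member_le_sum) (auto, simp add: words_def)

lemma fibre_prob_le_1: "fibre_prob p f w \<le> 1"
  for p :: "'m::finite pmf"
proof -
  have "fibre_prob p f w \<le> (\<Sum>v\<in>words (length w). word_prob p v)"
    unfolding fibre_prob_eq by (rule sum_mono2) auto
  also have "\<dots> = 1"
    using word_expectation_const[of p "length w" 1] by (simp add: word_expectation_def)
  finally show ?thesis .
qed

lemma word_map_append: "word_map f (u @ v) = word_map f u \<circ> word_map f v"
  by (induction u) auto

text \<open>Concatenating words equivalent to \<open>u\<close> and to \<open>v\<close> gives words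
  equivalent to \<open>u @ v\<close>, pairwise distinct because the lengths are fixed. Their
  probabilities are therefore part of the sum for \<open>u @ v\<close>.\<close>

lemma fibre_prob_append:
  fixes p :: "'m::finite pmf"
  shows "fibre_prob p f u * fibre_prob p f v \<le> fibre_prob p f (u @ v)"
proof -
  let ?F = "\<lambda>w. {v. v \<in> words (length w) \<and> word_map f v = word_map f w}"
  have inj: "inj_on (\<lambda>(x, y). x @ y) (?F u \<times> ?F v)"
    by (auto simp: inj_on_def words_def)
  have fin: "finite (?F w)" for w by simp
  have "fibre_prob p f u * fibre_prob p f v = (\<Sum>(x, y)\<in>?F u \<times> ?F v. word_prob p (x @ y))"
    unfolding fibre_prob_eq by (simp add: sum_product sum.cartesian_product word_prob_append)
  also have "\<dots> = (\<Sum>w\<in>(\<lambda>(x, y). x @ y) ` (?F u \<times> ?F v). word_prob p w)"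
    by (subst sum.reindex[OF inj]) (auto simp: case_prod_unfold)
  also have "\<dots> \<le> fibre_prob p f (u @ v)"
    unfolding fibre_prob_eq
    by (intro sum_mono2 fin) (auto simp: words_def word_map_append)
  finally show ?thesis .
qed

section \<open>Entropy of the classes as mean information\<close>

lemma equiv_word_equiv: "equiv (words n) (word_equiv f n)"
  by (auto simp: equiv_def refl_on_def sym_def trans_def word_equiv_def)

lemma finite_word_classes [simp]: "finite (word_classes f n)"
  for f :: "'m::finite \<Rightarrow> 'a \<Rightarrow> 'a"
  unfolding word_classes_def by (rule finite_quotient) (auto simp: word_equiv_def)

lemma sum_word_classes:
  fixes f :: "'m::finite \<Rightarrow> 'a \<Rightarrow> 'a"
  shows "(\<Sum>c\<in>word_classes f n. \<Sum>w\<in>c. g w) = (\<Sum>w\<in>words n. g w)"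
proof -
  have U: "\<Union>(word_classes f n) = words n"
    unfolding word_classes_def by (rule Union_quotient[OF equiv_word_equiv])
  have "finite c" if "c \<in> word_classes f n" for c
    using that U by (metis Union_upper finite_subset finite_words)
  moreover have "c \<inter> c' = {}" if "c \<in> word_classes f n" "c' \<in> word_classes f n" "c \<noteq> c'" for c c'
    using quotient_disj[OF equiv_word_equiv] that unfolding word_classes_def by blast
  ultimately show ?thesis
    using sum.Union_disjoint[of "word_classes f n" g] U by simp
qed

lemma class_prob_member:
  assumes "c \<in> word_classes f n" "w \<in> c"
  shows "class_prob p c = fibre_prob p f w"
proof -
  obtain v where v: "c = word_equiv f n `` {v}"
    using assms(1) unfolding word_classes_def by (auto elim: quotientE)
  then have "(v, w) \<in> word_equiv f n" using assms(2) by simp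
  then have "c = word_equiv f n `` {w}" "length w = n"
    using v equiv_class_eq[OF equiv_word_equiv] by (auto simp: word_equiv_def words_def)
  then show ?thesis by (simp add: fibre_prob_def)
qed

text \<open>Each class probability is a sum over words, and the logarithm is constant on the class,
  so the entropy is the mean information of a random word. In this form independence of blocks can
  be used.\<close>

lemma class_entropy_eq:
  fixes p :: "'m::finite pmf"
  shows "class_entropy p f n = word_expectation p n (\<lambda>w. - ln (fibre_prob p f w))"
proof -
  have "class_entropy p f n = (\<Sum>c\<in>word_classes f n. \<Sum>w\<in>c. word_prob p w * - ln (class_prob p c))"
    by (simp add: class_entropy_def class_prob_def word_prob_def sum_distrib_right sum_negf)
  also have "\<dots> = (\<Sum>c\<in>word_classes f n. \<Sum>w\<in>c. word_prob p w * - ln (fibre_prob p f w))"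
    by (intro sum.cong refl) (simp add: class_prob_member)
  finally show ?thesis
    by (simp only: sum_word_classes word_expectation_def)
qed

lemma class_entropy_nonneg: "0 \<le> class_entropy p f n"
  for p :: "'m::finite pmf"
proof -
  have "word_expectation p n (\<lambda>_. 0) \<le> class_entropy p f n"
    unfolding class_entropy_eq
  proof (rule word_expectation_mono)
    fix w assume "0 < word_prob p w"
    then have "0 < fibre_prob p f w" using word_prob_le_fibre_prob[of p w f] by linarith
    then show "0 \<le> - ln (fibre_prob p f w)" using fibre_prob_le_1[of p f w] by simp
  qed
  then show ?thesis by (simp add: word_expectation_const)
qed

text \<open>Pointwise subadditivity of information, from supermultiplicativity of the class
  probabilities. The positivity assumptions keep away from the default value
  \<open>ln 0 = 0\<close>.\<close>

lemma neg_ln_fibre_prob_append: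
  fixes p :: "'m::finite pmf"
  assumes "0 < word_prob p u" "0 < word_prob p v"
  shows "- ln (fibre_prob p f (u @ v)) \<le> - ln (fibre_prob p f u) - ln (fibre_prob p f v)"
proof -
  have pos: "0 < fibre_prob p f u" "0 < fibre_prob p f v"
    using assms word_prob_le_fibre_prob[of p u f] word_prob_le_fibre_prob[of p v f] by linarith+
  then have "ln (fibre_prob p f u * fibre_prob p f v) \<le> ln (fibre_prob p f (u @ v))"
    using fibre_prob_append[of p f u v]
    by (intro iffD2[OF ln_le_cancel_iff]) (auto intro: mult_pos_pos less_le_trans)
  then show ?thesis using pos by (simp add: ln_mult)
qed

lemma class_entropy_add: "class_entropy p f (n + l) \<le> class_entropy p f n + class_entropy p f l"
  for p :: "'m::finite pmf"
proof -
  let ?Y = "\<lambda>w. - ln (fibre_prob p f w)"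
  have "class_entropy p f (n + l) \<le>
      word_expectation p n (\<lambda>u. word_expectation p l (\<lambda>v. ?Y u + ?Y v))"
    unfolding class_entropy_eq word_expectation_add
    by (intro word_expectation_mono) (use neg_ln_fibre_prob_append in force)
  also have "\<dots> = class_entropy p f n + class_entropy p f l"
    by (simp only: word_expectation_plus word_expectation_const class_entropy_eq)
  finally show ?thesis .
qed

section \<open>Number of classes, growth rate and entropy rate\<close>

text \<open>All words of a class have the same map, so the image of the class is a singleton and
  \<open>the_elem\<close> extracts its element. Counting maps makes submultiplicativity a matter of
  composition.\<close>

lemma card_word_classes: "card (word_classes f n) = card (word_map f ` words n)"
proof (rule bij_betw_same_card[OF bij_betwI'])
  let ?F = "\<lambda>c. the_elem (word_map f ` c)"
  have F: "word_map f ` (word_equiv f n `` {w}) = {word_map f w}" if "w \<in> words n" for w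
    using that by (auto simp: word_equiv_def)
  show "?F c = ?F d \<longleftrightarrow> c = d" if "c \<in> word_classes f n" "d \<in> word_classes f n" for c d
    using that F unfolding word_classes_def
    by (auto elim!: quotientE simp: word_equiv_def)
  show "?F c \<in> word_map f ` words n" if "c \<in> word_classes f n" for c
    using that F unfolding word_classes_def by (auto elim!: quotientE)
  show "\<exists>c\<in>word_classes f n. g = ?F c" if g: "g \<in> word_map f ` words n" for g
  proof -
    obtain w where w: "w \<in> words n" "g = word_map f w" using g by auto
    then have "word_equiv f n `` {w} \<in> word_classes f n" "g = ?F (word_equiv f n `` {w})"
      unfolding word_classes_def by (simp_all add: quotientI F)
    then show ?thesis by blast
  qed
qed

lemma card_word_classes_pos: "0 < card (word_classes f n)"
  for f :: "'m::finite \<Rightarrow> 'a \<Rightarrow> 'a"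
proof -
  have "replicate n undefined \<in> (words n :: 'm list set)" by (simp add: words_def)
  then have "words n \<noteq> ({} :: 'm list set)" by blast
  then show ?thesis by (simp add: card_word_classes card_gt_0_iff)
qed

lemma card_word_classes_add:
  fixes f :: "'m::finite \<Rightarrow> 'a \<Rightarrow> 'a"
  shows "card (word_classes f (n + l)) \<le> card (word_classes f n) * card (word_classes f l)"
proof -
  have "word_map f ` words (n + l) \<subseteq>
      (\<lambda>(g, h). g \<circ> h) ` (word_map f ` words n \<times> word_map f ` words l)"
  proof
    fix g assume "g \<in> word_map f ` words (n + l)"
    then obtain w where w: "w \<in> words (n + l)" "g = word_map f w" by auto
    have "g = word_map f (take n w) \<circ> word_map f (drop n w)"
      using w word_map_append[of f "take n w" "drop n w"] by simp
    moreover have "take n w \<in> words n" "drop n w \<in> words l"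
      using w by (auto simp: words_def)
    ultimately show "g \<in> (\<lambda>(g, h). g \<circ> h) ` (word_map f ` words n \<times> word_map f ` words l)"
      by force
  qed
  then have "card (word_map f ` words (n + l)) \<le> card (word_map f ` words n \<times> word_map f ` words l)"
    by (rule surj_card_le[rotated]) simp
  then show ?thesis
    by (simp add: card_word_classes card_cartesian_product)
qed

text \<open>Gibbs' inequality against the uniform distribution on the classes, derived from
  \<open>ln x \<le> x - 1\<close>.\<close>

lemma class_entropy_le_ln_card:
  fixes p :: "'m::finite pmf"
  shows "class_entropy p f n \<le> ln (card (word_classes f n))"
proof -
  define K where "K = real (card (word_classes f n))"
  define D where "D = word_classes f n"
  have K: "0 < K" unfolding K_def using card_word_classes_pos[of f n] by simp
  have q: "0 \<le> class_prob p c" for c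
    unfolding class_prob_def word_prob_def[symmetric] by (simp add: sum_nonneg)
  have total: "(\<Sum>c\<in>D. class_prob p c) = 1"
    unfolding class_prob_def D_def sum_word_classes
    using word_expectation_const[of p n 1] by (simp add: word_expectation_def word_prob_def)
  \<comment> \<open>The right-hand sides add up to \<open>1 - 1 = 0\<close> over the
    \<open>K\<close> classes. A class of probability zero contributes \<open>0\<close> on the
    left.\<close>
  have "- (class_prob p c * ln (class_prob p c)) - class_prob p c * ln K \<le> 1 / K - class_prob p c" for c
  proof (cases "class_prob p c = 0")
    case False
    then have pos: "0 < class_prob p c" using q[of c] by simp
    have "ln (1 / (K * class_prob p c)) \<le> 1 / (K * class_prob p c) - 1"
      using K pos by (intro ln_le_minus_one) simp
    then have "class_prob p c * ln (1 / (K * class_prob p c)) \<le> class_prob p c * (1 / (K * class_prob p c) - 1)"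
      using pos by (intro mult_left_mono) auto
    then show ?thesis
      using K pos by (simp add: ln_div ln_mult algebra_simps)
  qed (use K in simp)
  then have "(\<Sum>c\<in>D. - (class_prob p c * ln (class_prob p c)) - class_prob p c * ln K)
      \<le> (\<Sum>c\<in>D. 1 / K - class_prob p c)"
    by (rule sum_mono)
  also have "\<dots> = 0"
    using K total by (auto simp: sum_subtractf K_def D_def)
  finally have "class_entropy p f n - ln K \<le> 0"
    using total
    by (simp add: sum_subtractf sum_distrib_right[symmetric] class_entropy_def sum_negf D_def)
  then show ?thesis by (simp add: K_def)
qed

text \<open>Identifies the product in the dimension bound with the entropy per letter. Fekete's
  lemma supplies the limits without which \<open>lim\<close> in the definitions would be
  unspecified.\<close>

lemma class_entropy_LIMSEQ:
  fixes p :: "'m::finite pmf" and f :: "'m \<Rightarrow> 'a \<Rightarrow> 'a"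
  shows "(\<lambda>n. class_entropy p f n / real n) \<longlonglongrightarrow> walk_entropy p f * ln (growth_rate f)"
proof -
  obtain h where h: "(\<lambda>n. class_entropy p f n / real n) \<longlonglongrightarrow> h"
    using subadditive_nonneg_LIMSEQ[of "class_entropy p f"]
      class_entropy_add class_entropy_nonneg by blast
  let ?a = "\<lambda>n. ln (real (card (word_classes f n)))"
  have pos: "1 \<le> real (card (word_classes f n))" for n
    using card_word_classes_pos[of f n] by linarith
  have "?a (n + l) \<le> ?a n + ?a l" for n l
  proof -
    have "ln (real (card (word_classes f (n + l)))) \<le>
        ln (real (card (word_classes f n)) * real (card (word_classes f l)))"
      using card_word_classes_add[of f n l] card_word_classes_pos[of f]
      by (intro ln_mono) (simp_all flip: of_nat_mult)
    then show ?thesis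
      using card_word_classes_pos[of f] by (simp add: ln_mult card_gt_0_iff)
  qed
  then obtain L where L: "(\<lambda>n. ?a n / real n) \<longlonglongrightarrow> L"
    using subadditive_nonneg_LIMSEQ[of ?a] pos by (meson ln_ge_zero)
  have "(\<lambda>n. exp (?a n / real n)) \<longlonglongrightarrow> exp L"
    by (intro tendsto_intros L)
  \<comment> \<open>The length \<open>0\<close> is excluded because \<open>root 0\<close> is only a
    default value.\<close>
  moreover have "\<forall>\<^sub>F n in sequentially. exp (?a n / real n) = root n (card (word_classes f n))"
    using eventually_gt_at_top[of 0]
    by eventually_elim (use card_word_classes_pos[of f] in \<open>simp add: root_powr_inverse powr_def card_gt_0_iff\<close>)
  ultimately have "(\<lambda>n. root n (card (word_classes f n))) \<longlonglongrightarrow> exp L"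
    by (rule Lim_transform_eventually)
  then have theta: "growth_rate f = exp L"
    unfolding growth_rate_def by (rule limI)
  show ?thesis
  proof (cases "growth_rate f > 1")
    case True
    then have ln: "ln (growth_rate f) > 0" by simp
    have "(\<lambda>n. class_entropy p f n / real n / ln (growth_rate f)) \<longlonglongrightarrow> h / ln (growth_rate f)"
      using ln by (intro tendsto_intros h) simp
    then have "walk_entropy p f = h / ln (growth_rate f)"
      using True by (simp add: walk_entropy_def limI)
    then show ?thesis using h ln by simp
  next
    \<comment> \<open>The convention that the entropy is \<open>0\<close> agrees with the limit
      here: \<open>0 \<le> h \<le> L \<le> 0\<close>, where \<open>L\<close> is the logarithm of the
      growth rate.\<close>
    case False
    then have "L \<le> 0" by (simp add: theta)
    moreover have "h \<le> L"
      by (rule LIMSEQ_le[OF h L]) (auto intro!: divide_right_mono class_entropy_le_ln_card)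
    moreover have "0 \<le> h"
      by (rule LIMSEQ_le_const[OF h]) (auto intro!: divide_nonneg_nonneg class_entropy_nonneg)
    ultimately have "h = 0" by linarith
    then show ?thesis using h False by (simp add: walk_entropy_def)
  qed
qed

section \<open>Typical words\<close>

text \<open>On random words of length \<open>k * N\<close> the summands are independent copies of
  \<open>Y\<close> on random words of length \<open>N\<close>.\<close>

primrec block_sum :: "('m list \<Rightarrow> real) \<Rightarrow> nat \<Rightarrow> nat \<Rightarrow> 'm list \<Rightarrow> real" where
  "block_sum Y N 0 w = 0"
| "block_sum Y N (Suc k) w = Y (take N w) + block_sum Y N k (drop N w)"

lemma word_expectation_block_sum:
  fixes p :: "'m::finite pmf"
  shows "word_expectation p (k * N) (block_sum Y N k) = k * word_expectation p N Y"
proof (induction k)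
  case (Suc k)
  have "word_expectation p (Suc k * N) (block_sum Y N (Suc k)) =
      word_expectation p N (\<lambda>u. word_expectation p (k * N) (\<lambda>v. Y u + block_sum Y N k v))"
    unfolding mult_Suc word_expectation_add
    by (intro word_expectation_cong) (simp add: words_def)
  then show ?case
    by (simp only: word_expectation_plus word_expectation_const Suc) (simp add: algebra_simps)
qed (simp add: word_expectation_const)

text \<open>Bienayme's identity, by splitting off the first block: the cross term vanishes because
  the other blocks are independent of it and their centred sum has mean zero.\<close>

lemma word_expectation_block_sum_variance:
  fixes p :: "'m::finite pmf" and Y :: "'m list \<Rightarrow> real" and N :: nat
  defines "m \<equiv> word_expectation p N Y"
  shows "word_expectation p (k * N) (\<lambda>w. (block_sum Y N k w - k * m)\<^sup>2) =
    k * word_expectation p N (\<lambda>u. (Y u - m)\<^sup>2)"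
proof (induction k)
  case (Suc k)
  let ?S = "\<lambda>v. block_sum Y N k v - k * m"
  have centred: "word_expectation p (k * N) ?S = 0"
    using word_expectation_plus[of p "k * N" "block_sum Y N k" "\<lambda>_. - (k * m)"]
    by (simp add: word_expectation_const word_expectation_block_sum m_def)
  have "word_expectation p (Suc k * N) (\<lambda>w. (block_sum Y N (Suc k) w - Suc k * m)\<^sup>2) =
      word_expectation p N (\<lambda>u. word_expectation p (k * N)
        (\<lambda>v. (Y u - m)\<^sup>2 + (2 * (Y u - m) * ?S v + (?S v)\<^sup>2)))"
    unfolding mult_Suc word_expectation_add
    by (intro word_expectation_cong) (simp add: words_def algebra_simps power2_eq_square)
  also have "\<dots> = word_expectation p N (\<lambda>u. (Y u - m)\<^sup>2) + word_expectation p (k * N) (\<lambda>v. (?S v)\<^sup>2)"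
    by (simp only: word_expectation_plus word_expectation_const word_expectation_cmult centred)
      (simp add: word_expectation_plus word_expectation_const)
  finally show ?case using Suc by (simp add: algebra_simps)
qed (simp add: word_expectation_const)

text \<open>Chebyshev's inequality for the deviation \<open>k * (t - m)\<close>: the variance grows
  linearly in \<open>k\<close>, the squared deviation quadratically.\<close>

lemma block_sum_weak_law:
  fixes p :: "'m::finite pmf" and t :: real
  assumes "word_expectation p N Y < t"
  shows "(\<lambda>k. word_expectation p (k * N) (\<lambda>w. of_bool (k * t \<le> block_sum Y N k w))) \<longlonglongrightarrow> 0"
proof -
  define m where "m = word_expectation p N Y"
  define V where "V = word_expectation p N (\<lambda>u. (Y u - m)\<^sup>2)"
  have e: "0 < t - m" using assms by (simp add: m_def)
  have bound: "word_expectation p (k * N) (\<lambda>w. of_bool (k * t \<le> block_sum Y N k w)) \<le>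
      V / (t - m)\<^sup>2 / k" if "k > 0" for k
  proof -
    have "word_expectation p (k * N) (\<lambda>w. of_bool (k * t \<le> block_sum Y N k w)) \<le>
        word_expectation p (k * N)
          (\<lambda>w. (1 / (k * (t - m))\<^sup>2) * (block_sum Y N k w - k * m)\<^sup>2)"
    proof (rule word_expectation_mono)
      fix w
      show "of_bool (k * t \<le> block_sum Y N k w) \<le>
          (1 / (k * (t - m))\<^sup>2) * (block_sum Y N k w - k * m)\<^sup>2"
      proof (cases "k * t \<le> block_sum Y N k w")
        case True
        then have "(k * (t - m))\<^sup>2 \<le> (block_sum Y N k w - k * m)\<^sup>2"
          using e by (intro power_mono) (auto simp: algebra_simps intro: mult_right_mono)
        then show ?thesis using True e that by simp
      qed simp
    qed
    also have "\<dots> = V / (t - m)\<^sup>2 / k"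
      unfolding word_expectation_cmult m_def word_expectation_block_sum_variance
      using that by (simp add: V_def m_def power2_eq_square)
    finally show ?thesis .
  qed
  show ?thesis
  proof (rule tendsto_sandwich[OF _ _ tendsto_const lim_const_over_n])
    show "\<forall>\<^sub>F k in sequentially. word_expectation p (k * N)
        (\<lambda>w. of_bool (k * t \<le> block_sum Y N k w)) \<le> V / (t - m)\<^sup>2 / k"
      using eventually_gt_at_top[of 0] by eventually_elim (rule bound)
    show "\<forall>\<^sub>F k in sequentially. 0 \<le> word_expectation p (k * N)
        (\<lambda>w. of_bool (k * t \<le> block_sum Y N k w))"
      by (simp add: word_expectation_def sum_nonneg)
  qed
qed

text \<open>The information of a long word is not a sum of independent terms, but subadditivity
  dominates it by one, to which the weak law applies.\<close>

lemma neg_ln_fibre_prob_le_block_sum: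
  fixes p :: "'m::finite pmf"
  assumes "w \<in> words (k * N)" "0 < word_prob p w"
  shows "- ln (fibre_prob p f w) \<le> block_sum (\<lambda>u. - ln (fibre_prob p f u)) N k w"
  using assms
proof (induction k arbitrary: w)
  case 0
  then have "w = []" by (simp add: words_def)
  then have "fibre_prob p f w \<ge> 1" using word_prob_le_fibre_prob[of p w f] by (simp add: word_prob_def)
  then show ?case by simp
next
  case (Suc k)
  have prod: "word_prob p w = word_prob p (take N w) * word_prob p (drop N w)"
    by (metis append_take_drop_id word_prob_append)
  then have pos: "0 < word_prob p (take N w)" "0 < word_prob p (drop N w)"
    using Suc.prems(2) word_prob_nonneg
    by (metis less_eq_real_def mult_zero_left mult_zero_right)+
  have "- ln (fibre_prob p f (drop N w)) \<le> block_sum (\<lambda>u. - ln (fibre_prob p f u)) N k (drop N w)"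
    using Suc.prems(1) pos by (intro Suc.IH) (auto simp: words_def)
  then show ?case
    using neg_ln_fibre_prob_append[OF pos, of f] by simp
qed

lemma small_fibre_prob_LIMSEQ:
  fixes p :: "'m::finite pmf"
  assumes "walk_entropy p f * ln (growth_rate f) < b"
  obtains N where "N > 0"
    "(\<lambda>k. word_expectation p (k * N) (\<lambda>w. of_bool (fibre_prob p f w < exp (- (real (k * N) * b)))))
      \<longlonglongrightarrow> 0"
proof -
  have "\<forall>\<^sub>F n in sequentially. class_entropy p f n / real n < b \<and> 0 < n"
    using order_tendstoD(2)[OF class_entropy_LIMSEQ assms] eventually_gt_at_top[of 0]
    by eventually_elim simp
  then obtain N where N: "class_entropy p f N / real N < b" "0 < N"
    by (auto simp: eventually_sequentially)
  let ?Y = "\<lambda>w. - ln (fibre_prob p f w)"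
  \<comment> \<open>The weak law is used with threshold \<open>t = N * b\<close> per block, so that
    \<open>k * t\<close> is \<open>b\<close> times the word length \<open>k * N\<close>.\<close>
  have "word_expectation p N ?Y < real N * b"
    using N by (simp add: class_entropy_eq[symmetric] field_simps)
  note lim = block_sum_weak_law[OF this]
  have "(\<lambda>k. word_expectation p (k * N) (\<lambda>w. of_bool (fibre_prob p f w < exp (- (real (k * N) * b)))))
      \<longlonglongrightarrow> 0"
  proof (rule tendsto_sandwich[OF _ _ tendsto_const lim])
    show "\<forall>\<^sub>F k in sequentially.
        word_expectation p (k * N) (\<lambda>w. of_bool (fibre_prob p f w < exp (- (real (k * N) * b))))
        \<le> word_expectation p (k * N) (\<lambda>w. of_bool (k * (real N * b) \<le> block_sum ?Y N k w))"
    proof (intro always_eventually allI word_expectation_mono)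
      fix k w assume w: "w \<in> words (k * N)" "0 < word_prob p w"
      have pos: "0 < fibre_prob p f w" using w word_prob_le_fibre_prob[of p w f] by linarith
      have "k * (real N * b) \<le> block_sum ?Y N k w" if "fibre_prob p f w < exp (- (real (k * N) * b))"
      proof -
        have "ln (fibre_prob p f w) < - (real (k * N) * b)"
          using that pos by (metis exp_gt_zero ln_exp ln_less_cancel_iff)
        then show ?thesis
          using neg_ln_fibre_prob_le_block_sum[OF w, of f] by simp
      qed
      then show "(of_bool (fibre_prob p f w < exp (- (real (k * N) * b))) :: real)
          \<le> of_bool (k * (real N * b) \<le> block_sum ?Y N k w)" by simp
    qed
  qed (simp add: word_expectation_def sum_nonneg)
  then show thesis using N that by blast
qed

section \<open>Prefix events of the Bernoulli measure and contraction in probability\<close>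

lemma prob_space_bernoulli_measure: "prob_space (bernoulli_measure p)"
  unfolding bernoulli_measure_def by (rule prob_space_PiM) (rule measure_pmf.prob_space_axioms)

lemma cylinder_bernoulli_measure:
  fixes p :: "'m::finite pmf"
  shows "{\<omega>. map \<omega> [0..<length w] = w} \<in> sets (bernoulli_measure p)" (is ?sets)
    and "measure (bernoulli_measure p) {\<omega>. map \<omega> [0..<length w] = w} = word_prob p w" (is ?meas)
proof -
  interpret product_prob_space "\<lambda>_. measure_pmf p" "UNIV :: nat set"
    by unfold_locales
  have cyl: "{\<omega>. map \<omega> [0..<length w] = w} =
      {\<omega> \<in> space (bernoulli_measure p). \<forall>i\<in>{..<length w}. \<omega> i \<in> {w ! i}}"
  proof -
    have "space (bernoulli_measure p) = UNIV"
      by (simp add: bernoulli_measure_def space_PiM)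
    moreover have "map \<omega> [0..<length w] = w \<longleftrightarrow> (\<forall>i<length w. \<omega> i = w ! i)" for \<omega>
      by (simp add: list_eq_iff_nth_eq[of _ w])
    ultimately show ?thesis by auto
  qed
  show ?sets
    unfolding cyl bernoulli_measure_def by measurable
  have "emeasure (bernoulli_measure p) {\<omega>. map \<omega> [0..<length w] = w} =
      (\<Prod>i<length w. emeasure (measure_pmf p) {w ! i})"
    unfolding cyl bernoulli_measure_def by (rule emeasure_PiM_Collect) auto
  also have "\<dots> = ennreal (word_prob p w)"
    unfolding word_prob_def prod.list_conv_set_nth
    by (simp add: emeasure_pmf_single prod_ennreal atLeast0LessThan)
  finally show ?meas
    by (simp add: measure_def)
qed

text \<open>An event determined by the first \<open>n\<close> letters is a finite disjoint union of
  cylinders, whose measures are the word probabilities.\<close>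

lemma prefix_event_bernoulli_measure:
  fixes p :: "'m::finite pmf"
  shows "{\<omega>. P (map \<omega> [0..<n])} \<in> sets (bernoulli_measure p)" (is ?sets)
    and "measure (bernoulli_measure p) {\<omega>. P (map \<omega> [0..<n])} =
      word_expectation p n (\<lambda>w. of_bool (P w))" (is ?meas)
proof -
  interpret prob_space "bernoulli_measure p"
    by (rule prob_space_bernoulli_measure)
  let ?C = "\<lambda>w. {\<omega>. map \<omega> [0..<n] = w}" and ?W = "{w \<in> words n. P w}"
  have U: "{\<omega>. P (map \<omega> [0..<n])} = (\<Union>w\<in>?W. ?C w)"
    by (auto simp: words_def)
  have C: "?C w \<in> sets (bernoulli_measure p)" "prob (?C w) = word_prob p w" if "w \<in> ?W" for w
    using that cylinder_bernoulli_measure[where w = w and p = p] by (auto simp: words_def)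
  show ?sets unfolding U using C by (intro sets.finite_UN) auto
  have "prob (\<Union>w\<in>?W. ?C w) = (\<Sum>w\<in>?W. prob (?C w))"
    using C by (intro finite_measure_finite_Union) (auto simp: disjoint_family_on_def)
  also have "\<dots> = (\<Sum>w\<in>?W. word_prob p w)"
    using C by (intro sum.cong) auto
  also have "\<dots> = word_expectation p n (\<lambda>w. of_bool (P w))"
    unfolding word_expectation_def by (rule sum.mono_neutral_cong_left) auto
  finally show ?meas unfolding U .
qed

text \<open>Almost sure convergence implies convergence in probability: the indicators of failure
  tend to \<open>0\<close> almost everywhere and are dominated by \<open>1\<close>.\<close>

lemma AE_eventually_prefix_LIMSEQ:
  fixes p :: "'m::finite pmf"
  assumes "AE \<omega> in bernoulli_measure p. \<forall>\<^sub>F n in sequentially. P (map \<omega> [0..<n])"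
  shows "(\<lambda>n. word_expectation p n (\<lambda>w. of_bool (\<not> P w))) \<longlonglongrightarrow> 0"
proof -
  interpret prob_space "bernoulli_measure p"
    by (rule prob_space_bernoulli_measure)
  let ?B = "\<lambda>n. {\<omega>. \<not> P (map \<omega> [0..<n])}"
  have meas: "?B n \<in> events" for n
    by (rule prefix_event_bernoulli_measure)
  have "(\<lambda>n. \<integral>\<omega>. indicator (?B n) \<omega> \<partial>bernoulli_measure p) \<longlonglongrightarrow> (\<integral>\<omega>. (0::real) \<partial>bernoulli_measure p)"
  proof (rule integral_dominated_convergence[where w = "\<lambda>_. 1"])
    show "AE \<omega> in bernoulli_measure p. (\<lambda>n. indicator (?B n) \<omega> :: real) \<longlonglongrightarrow> 0"
      using assms
      by eventually_elim (auto intro!: tendsto_eventually elim!: eventually_mono)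
  qed (use meas in auto)
  moreover have "(\<integral>\<omega>. indicator (?B n) \<omega> \<partial>bernoulli_measure p) =
      word_expectation p n (\<lambda>w. of_bool (\<not> P w))" for n
    using meas[of n] prefix_event_bernoulli_measure(2)[where P = "\<lambda>w. \<not> P w" and n = n and p = p]
    by simp
  ultimately show ?thesis by simp
qed

lemma large_lipschitz_const_LIMSEQ:
  fixes p :: "'m::finite pmf" and f :: "'m \<Rightarrow> 'a::metric_space \<Rightarrow> 'a"
  assumes "contracts_on_average p f chi" and "chi < a"
  shows "(\<lambda>n. word_expectation p n
    (\<lambda>w. of_bool (\<not> lipschitz_const (word_map f w) < exp (real n * a)))) \<longlonglongrightarrow> 0"
proof -
  \<comment> \<open>The length is read off the word, since the predicate on prefixes may depend on
    the word only.\<close>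
  let ?P = "\<lambda>w. lipschitz_const (word_map f w) < exp (real (length w) * a)"
  have "AE \<omega> in bernoulli_measure p. \<forall>\<^sub>F n in sequentially. ?P (map \<omega> [0..<n])"
    using conjunct2[OF assms(1)[unfolded contracts_on_average_def]]
  proof eventually_elim
    case (elim \<omega>)
    then have "\<forall>\<^sub>F n in sequentially.
        elog (lipschitz_const (word_map f (map \<omega> [0..<n]))) / ereal (real n) < ereal a"
      using assms(2) by (intro order_tendstoD(2)) auto
    then show ?case
      using eventually_gt_at_top[of 0]
    proof eventually_elim
      case (elim n)
      let ?L = "lipschitz_const (word_map f (map \<omega> [0..<n]))"
      show ?case
      proof (cases "?L > 0")
        case True
        then have "ln ?L < real n * a"
          using elim by (simp add: elog_def field_simps)
        then show ?thesis using True
          by (metis exp_less_cancel_iff exp_ln length_map length_upt minus_nat.diff_0)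
      next
        \<comment> \<open>A constant that is not positive, as for a constant map, is below any
          exponential without taking logarithms.\<close>
        case False
        then have "?L \<le> 0" by simp
        also have "0 < exp (real n * a)" by simp
        finally show ?thesis by simp
      qed
    qed
  qed
  from AE_eventually_prefix_LIMSEQ[OF this]
  show ?thesis
    by (rule Lim_transform_eventually)
      (auto intro!: always_eventually word_expectation_cong simp: words_def)
qed

section \<open>Lower local dimension\<close>

text \<open>Each tail union contains sets of probability arbitrarily close to \<open>1\<close>,
  hence has full probability, and so does the intersection of the countably many tail unions. Thus
  convergence in probability already yields what a lower limit asks for.\<close>

lemma (in prob_space) AE_frequently_if_prob_LIMSEQ_1:
  assumes X: "\<And>k. X k \<in> events" and lim: "(\<lambda>k. prob (X k)) \<longlonglongrightarrow> 1"
  shows "AE x in M. \<exists>\<^sub>F k in sequentially. x \<in> X k"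
proof -
  have "AE x in M. \<exists>k\<ge>m. x \<in> X k" for m
  proof -
    have U: "(\<Union>k\<in>{m..}. X k) \<in> events" using X by (intro sets.countable_UN) auto
    have "1 \<le> prob (\<Union>k\<in>{m..}. X k)"
      by (rule LIMSEQ_le_const2[OF lim])
        (auto intro!: exI[of _ m] finite_measure_mono U)
    then have "prob (\<Union>k\<in>{m..}. X k) = 1" using prob_le_1 by (simp add: antisym)
    then show ?thesis
      using AE_prob_1 by fastforce
  qed
  then have "AE x in M. \<forall>m. \<exists>k\<ge>m. x \<in> X k" by (simp add: AE_all_countable)
  then show ?thesis by (simp add: frequently_sequentially)
qed

section \<open>Measurability of the lower local dimension\<close>

text \<open>The ball is a section of the open set of pairs at distance below \<open>r\<close>. By
  second countability this set is product measurable, so the measure of its sections is a measurable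
  function.\<close>

lemma borel_measurable_measure_ball:
  fixes \<mu> :: "'a::{metric_space,second_countable_topology} measure"
  assumes "prob_space \<mu>" and "sets \<mu> = sets borel"
  shows "(\<lambda>x. measure \<mu> (ball x r)) \<in> borel_measurable borel"
proof -
  interpret prob_space \<mu> by fact
  have "open {z :: 'a \<times> 'a. dist (fst z) (snd z) < r}"
    by (intro open_Collect_less continuous_intros)
  then have "{z :: 'a \<times> 'a. dist (fst z) (snd z) < r} \<in> sets (borel \<Otimes>\<^sub>M \<mu>)"
    unfolding sets_pair_measure_cong[OF refl assms(2)] borel_prod by simp
  from measurable_emeasure_Pair[OF this]
  have "(\<lambda>x. emeasure \<mu> (ball x r)) \<in> borel_measurable borel"
    by (simp add: vimage_def ball_def)
  then show ?thesis
    unfolding measure_def by measurable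
qed

text \<open>Reduces an uncountable infimum over radii to a countable one. Radii below
  \<open>1\<close> have negative logarithm, so a larger measure gives a smaller quotient.\<close>

lemma rational_radii_suffice:
  fixes \<mu> :: "'a::metric_space measure"
  assumes "prob_space \<mu>" and sets: "sets \<mu> = sets borel"
    and r: "0 < r" "r < \<delta>" and "\<delta> \<le> 1"
  shows "(INF q\<in>\<rat> \<inter> {0<..<\<delta>}. elog (measure \<mu> (ball x q)) / ereal (ln q))
    \<le> elog (measure \<mu> (ball x r)) / ereal (ln r)"
proof (rule dense_ge)
  fix y assume y: "elog (measure \<mu> (ball x r)) / ereal (ln r) < y"
  interpret prob_space \<mu> by fact
  define m where "m = measure \<mu> (ball x r)"
  have lnr: "ln r < 0" using assms by simp
  \<comment> \<open>For \<open>m = 0\<close> the quotient is \<open>- \<infinity>\<close> over a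
    negative number, that is \<open>\<infinity>\<close>, and cannot lie below
    \<open>y\<close>.\<close>
  have "m \<noteq> 0" using y lnr by (auto simp: m_def elog_def)
  then have m: "0 < m" unfolding m_def using zero_less_measure_iff by blast
  have "((\<lambda>q. ereal (ln m / ln q)) \<longlongrightarrow> ereal (ln m / ln r)) (at_right r)"
    using r lnr by (intro tendsto_intros) auto
  moreover have "ereal (ln m / ln r) < y"
    using y m lnr by (simp add: m_def[symmetric] elog_def)
  ultimately have "\<forall>\<^sub>F q in at_right r. ereal (ln m / ln q) < y"
    by (rule order_tendstoD(2))
  then obtain c where c: "r < c" "\<And>q. r < q \<Longrightarrow> q < c \<Longrightarrow> ereal (ln m / ln q) < y"
    unfolding eventually_at_right_field by blast
  \<comment> \<open>A slightly larger rational radius: the measure grows, and the logarithm of the radius is continuous.\<close>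
  obtain q where q: "q \<in> \<rat>" "r < q" "q < min c \<delta>"
    using Rats_dense_in_real[of r "min c \<delta>"] c r by auto
  have "m \<le> measure \<mu> (ball x q)"
    unfolding m_def using q by (intro finite_measure_mono) (auto simp: sets)
  moreover have "ln q < 0" using q r assms(5) by simp
  ultimately have "elog (measure \<mu> (ball x q)) / ereal (ln q) \<le> ereal (ln m / ln q)"
    using m by (simp add: elog_def divide_right_mono_neg)
  also have "\<dots> < y" using c q by simp
  finally have "elog (measure \<mu> (ball x q)) / ereal (ln q) \<le> y" by simp
  then show "(INF q\<in>\<rat> \<inter> {0<..<\<delta>}. elog (measure \<mu> (ball x q)) / ereal (ln q)) \<le> y"
    by (rule INF_lower2[rotated]) (use q r in auto)
qed

lemma lower_local_dim_eq_rational: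
  fixes \<mu> :: "'a::metric_space measure"
  assumes "prob_space \<mu>" and "sets \<mu> = sets borel"
  shows "lower_local_dim \<mu> x =
    (SUP n. INF q\<in>\<rat> \<inter> {0<..<inverse (real (Suc n))}. elog (measure \<mu> (ball x q)) / ereal (ln q))"
  unfolding lower_local_dim_def Liminf_within
proof (intro antisym SUP_least)
  fix e :: real assume "e \<in> {0<..}"
  then obtain n where n: "inverse (real (Suc n)) < e"
    using reals_Archimedean by auto
  show "(INF y\<in>{0<..} \<inter> ball 0 e - {0}. elog (measure \<mu> (ball x y)) / ereal (ln y))
    \<le> (SUP n. INF q\<in>\<rat> \<inter> {0<..<inverse (real (Suc n))}. elog (measure \<mu> (ball x q)) / ereal (ln q))"
    by (rule SUP_upper2[of n]) (use n in \<open>auto intro!: INF_superset_mono\<close>)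
next
  fix n :: nat
  show "(INF q\<in>\<rat> \<inter> {0<..<inverse (real (Suc n))}. elog (measure \<mu> (ball x q)) / ereal (ln q))
    \<le> (SUP e\<in>{0<..}. INF y\<in>{0<..} \<inter> ball 0 e - {0}. elog (measure \<mu> (ball x y)) / ereal (ln y))"
  proof (rule SUP_upper2[of "inverse (real (Suc n))"])
    show "(INF q\<in>\<rat> \<inter> {0<..<inverse (real (Suc n))}. elog (measure \<mu> (ball x q)) / ereal (ln q))
      \<le> (INF y\<in>{0<..} \<inter> ball 0 (inverse (real (Suc n))) - {0}. elog (measure \<mu> (ball x y)) / ereal (ln y))"
      by (intro INF_greatest rational_radii_suffice assms) (auto simp: field_simps)
  qed auto
qed

text \<open>Needed because \<open>esssup\<close> is \<open>top\<close> on functions that are not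
  measurable. Countable suprema and infima preserve measurability once the radii are
  rational.\<close>

lemma borel_measurable_lower_local_dim:
  fixes \<mu> :: "'a::{metric_space,second_countable_topology} measure"
  assumes "prob_space \<mu>" and "sets \<mu> = sets borel"
  shows "lower_local_dim \<mu> \<in> borel_measurable \<mu>"
proof -
  have [measurable]: "(\<lambda>x. measure \<mu> (ball x q)) \<in> borel_measurable \<mu>" for q
    using borel_measurable_measure_ball[OF assms] measurable_cong_sets[OF assms(2) refl] by blast
  have [simp]: "countable (\<rat> \<inter> {0<..<c :: real})" for c
    by (rule countable_Int1[OF countable_rat])
  show ?thesis
    unfolding lower_local_dim_eq_rational[OF assms, abs_def] elog_def
    by measurable
qed

text \<open>At radius \<open>exp (n * a)\<close> the measure bound makes the quotient at most
  \<open>(- n * b) / (n * a) = b / - a\<close>. These radii tend to \<open>0\<close>, so infinitely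
  many \<open>n\<close> bound the lower limit.\<close>

lemma lower_local_dim_le:
  fixes \<mu> :: "'a::metric_space measure"
  assumes freq: "\<exists>\<^sub>F n in sequentially. exp (- (real n * b)) \<le> measure \<mu> (ball x (exp (real n * a)))"
    and a: "a < 0"
  shows "lower_local_dim \<mu> x \<le> ereal (b / - a)"
proof (rule ccontr)
  assume "\<not> lower_local_dim \<mu> x \<le> ereal (b / - a)"
  then have ev: "\<forall>\<^sub>F r in at_right 0. ereal (b / - a) < elog (measure \<mu> (ball x r)) / ereal (ln r)"
    unfolding lower_local_dim_def by (intro less_LiminfD) simp
  have "filterlim (\<lambda>n. exp (real n * a)) (at_right 0) sequentially"
  proof -
    have "(\<lambda>n. exp a ^ n) \<longlonglongrightarrow> 0" using a by (intro LIMSEQ_power_zero) simp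
    then have "(\<lambda>n. exp (real n * a)) \<longlonglongrightarrow> 0" by (simp add: exp_of_nat_mult)
    then show ?thesis by (simp add: filterlim_at)
  qed
  from eventually_compose_filterlim[OF ev this]
  have "\<forall>\<^sub>F n in sequentially. \<not> exp (- (real n * b)) \<le> measure \<mu> (ball x (exp (real n * a)))"
    using eventually_gt_at_top[of 0]
  proof eventually_elim
    case (elim n)
    let ?m = "measure \<mu> (ball x (exp (real n * a)))"
    show ?case
    proof
      assume le: "exp (- (real n * b)) \<le> ?m"
      then have m: "0 < ?m" by (rule less_le_trans[rotated]) simp
      have na: "real n * a < 0" using elim a by (simp add: mult_pos_neg)
      have "- (real n * b) \<le> ln ?m" using le m by (simp add: ln_ge_iff)
      then have "ln ?m / (real n * a) \<le> - (real n * b) / (real n * a)"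
        using na by (intro divide_right_mono_neg) auto
      also have "\<dots> = b / - a" using elim by simp
      finally show False using elim m a by (simp add: elog_def)
    qed
  qed
  then show False using freq by (simp add: frequently_def)
qed

section \<open>Lipschitz word maps and iterated stationarity\<close>

lemma lipschitz_map_word_map:
  assumes "\<And>i. lipschitz_map (f i)"
  shows "lipschitz_map (word_map f w)"
proof (induction w)
  case Nil
  show ?case by (auto simp: lipschitz_map_def id_def intro: lipschitz_intros)
next
  case (Cons i w)
  then show ?case
    using assms[of i] unfolding lipschitz_map_def
    by (metis lipschitz_on_compose lipschitz_on_subset subset_UNIV word_map.simps(2))
qed

lemma lipschitz_map_imp_continuous_on: "lipschitz_map g \<Longrightarrow> continuous_on UNIV g"
  unfolding lipschitz_map_def using lipschitz_on_continuous_on by blast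

text \<open>The Lipschitz constant is an infimum, so the strict inequality is what provides an
  actual Lipschitz bound \<open>L' < L\<close>.\<close>

lemma lipschitz_const_less_imp_dist:
  assumes "lipschitz_map g" "lipschitz_const g < L" "dist x y < D"
  shows "dist (g x) (g y) < L * D"
proof -
  have "\<exists>L'\<in>{L. L-lipschitz_on UNIV g}. L' < L"
    using assms(1,2) unfolding lipschitz_const_def lipschitz_map_def
    by (subst (asm) cInf_less_iff) (auto intro!: bdd_belowI[of _ 0] simp: lipschitz_on_nonneg)
  then obtain L' where L': "L'-lipschitz_on UNIV g" "L' < L" by blast
  have D: "0 < D" using assms(3) zero_le_dist[of x y] by linarith
  have "dist (g x) (g y) \<le> L' * dist x y" by (rule lipschitz_onD[OF L'(1)]) auto
  also have "\<dots> \<le> L' * D"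
    using lipschitz_on_nonneg[OF L'(1)] assms(3) by (intro mult_left_mono) auto
  also have "\<dots> < L * D" using L'(2) D by simp
  finally show ?thesis .
qed

text \<open>The first letter is the outermost map, so a preimage under \<open>f i\<close> is taken
  first and the induction hypothesis is applied to that preimage; hence the generalisation over
  \<open>B\<close>.\<close>

lemma stationary_measure_words:
  fixes p :: "'m::finite pmf" and f :: "'m \<Rightarrow> 'a::metric_space \<Rightarrow> 'a"
  assumes lip: "\<And>i. lipschitz_map (f i)" and stat: "stationary_measure p f \<mu>"
    and B: "B \<in> sets borel"
  shows "measure \<mu> B = word_expectation p n (\<lambda>w. measure \<mu> (word_map f w -` B))"
  using B
proof (induction n arbitrary: B)
  case 0
  then show ?case by (simp add: word_expectation_def words_def word_prob_def)
next
  case (Suc n)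
  have sets: "f i -` B \<in> sets borel" for i
  proof -
    have "continuous_on UNIV (f i)"
      by (rule lipschitz_map_imp_continuous_on[OF lip])
    then show ?thesis
      using Suc.prems by (auto intro!: measurable_sets_borel borel_measurable_continuous_onI)
  qed
  have "measure \<mu> B = (\<Sum>i\<in>UNIV. pmf p i * measure \<mu> (f i -` B))"
    using stat Suc.prems by (simp add: stationary_measure_def)
  also have "\<dots> = (\<Sum>i\<in>UNIV. pmf p i *
      word_expectation p n (\<lambda>w. measure \<mu> (word_map f ([i] @ w) -` B)))"
    using Suc.IH[OF sets] by (simp add: vimage_comp)
  also have "\<dots> = word_expectation p (1 + n) (\<lambda>w. measure \<mu> (word_map f w -` B))"
    by (simp only: word_expectation_add word_expectation_1)
  finally show ?case by simp
qed

text \<open>Two points of \<open>ball x0 R\<close> are less than \<open>2 * R\<close> apart, so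
  \<open>f_w\<close> sends the whole ball into the target ball. Equivalent words have the same map,
  so iterated stationarity collects the probability of the whole class.\<close>

lemma good_word_image:
  fixes p :: "'m::finite pmf" and f :: "'m \<Rightarrow> 'a::metric_space \<Rightarrow> 'a"
  assumes lip: "\<And>i. lipschitz_map (f i)" and stat: "stationary_measure p f \<mu>"
    and L: "lipschitz_const (word_map f w) < L" and s: "L * (2 * R) \<le> s"
    and c: "c \<le> fibre_prob p f w * measure \<mu> (ball x0 R)"
    and y: "y \<in> ball x0 R"
  shows "c \<le> measure \<mu> (ball (word_map f w y) s)"
proof -
  interpret prob_space \<mu> using stat by (simp add: stationary_measure_def)
  have sets: "sets \<mu> = sets borel" using stat by (simp add: stationary_measure_def)
  let ?B = "ball (word_map f w y) s" and ?n = "length w"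
  let ?F = "{v. v \<in> words ?n \<and> word_map f v = word_map f w}"
  have sub: "ball x0 R \<subseteq> word_map f v -` ?B" if "v \<in> ?F" for v
  proof
    fix z assume "z \<in> ball x0 R"
    then have "dist y z < 2 * R"
      using y dist_triangle2[of y z x0] by (simp add: dist_commute)
    from lipschitz_const_less_imp_dist[OF lipschitz_map_word_map[OF lip] L this]
    show "z \<in> word_map f v -` ?B" using that s by simp
  qed
  have meas: "word_map f v -` ?B \<in> events" for v
  proof -
    have "continuous_on UNIV (word_map f v)"
      by (intro lipschitz_map_imp_continuous_on lipschitz_map_word_map lip)
    then have "open (word_map f v -` ?B)" by (intro open_vimage) auto
    then show ?thesis by (simp add: sets)
  qed
  have "fibre_prob p f w * prob (ball x0 R) = (\<Sum>v\<in>?F. word_prob p v * prob (ball x0 R))"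
    by (simp add: fibre_prob_eq sum_distrib_right)
  also have "\<dots> \<le> (\<Sum>v\<in>?F. word_prob p v * prob (word_map f v -` ?B))"
    by (intro sum_mono mult_left_mono finite_measure_mono sub meas word_prob_nonneg)
  also have "\<dots> \<le> (\<Sum>v\<in>words ?n. word_prob p v * prob (word_map f v -` ?B))"
    by (intro sum_mono2) auto
  also have "\<dots> = prob ?B"
    using stationary_measure_words[OF lip stat, of ?B ?n] by (simp add: word_expectation_def)
  finally show ?thesis using c by simp
qed

section \<open>Lower bounds for the measure of balls at typical points\<close>

lemma large_ball_measure_LIMSEQ:
  fixes p :: "'m::finite pmf" and f :: "'m \<Rightarrow> 'a::{metric_space,second_countable_topology} \<Rightarrow> 'a"
  assumes lip: "\<And>i. lipschitz_map (f i)" and contr: "contracts_on_average p f chi"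
    and stat: "stationary_measure p f \<mu>"
    and a: "chi < a" and b: "walk_entropy p f * ln (growth_rate f) < b"
  obtains N where "N > 0"
    "(\<lambda>k. measure \<mu> {x. exp (- (real (k * N) * b)) \<le> measure \<mu> (ball x (exp (real (k * N) * a)))})
      \<longlonglongrightarrow> 1"
proof -
  interpret prob_space \<mu> using stat by (simp add: stationary_measure_def)
  have sets: "sets \<mu> = sets borel" using stat by (simp add: stationary_measure_def)
  \<comment> \<open>The gaps \<open>a - a'\<close> and \<open>b - b'\<close> give exponential slack,
    which for large \<open>n\<close> absorbs the factors \<open>2 * R\<close> and
    \<open>1 / m\<close> coming from the reference ball.\<close>
  obtain a' b' where a': "chi < a'" "a' < a"
    and b': "walk_entropy p f * ln (growth_rate f) < b'" "b' < b"
    using dense a b by metis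
  let ?few = "\<lambda>n w. fibre_prob p f w < exp (- (real n * b'))"
  let ?far = "\<lambda>n w. \<not> lipschitz_const (word_map f w) < exp (real n * a')"
  obtain N where N: "N > 0"
    and few: "(\<lambda>k. word_expectation p (k * N) (\<lambda>w. of_bool (?few (k * N) w))) \<longlonglongrightarrow> 0"
    using small_fibre_prob_LIMSEQ[OF b'(1)] by blast
  have kN: "filterlim (\<lambda>k. k * N) sequentially sequentially"
    using N by (intro filterlim_subseq strict_monoI) simp
  have far: "(\<lambda>k. word_expectation p (k * N) (\<lambda>w. of_bool (?far (k * N) w))) \<longlonglongrightarrow> 0"
    using filterlim_compose[OF large_lipschitz_const_LIMSEQ[OF contr a'(1)] kN] .
  let ?X = "\<lambda>n. {x. exp (- (real n * b)) \<le> measure \<mu> (ball x (exp (real n * a)))}"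
  have X: "?X n \<in> sets borel" for n
    using borel_measurable_measure_ball[OF prob_space_axioms sets, measurable] by measurable
  have preX: "word_map f w -` ?X n \<in> events" for w n
  proof -
    have "continuous_on UNIV (word_map f w)"
      by (intro lipschitz_map_imp_continuous_on lipschitz_map_word_map lip)
    then have "word_map f w \<in> borel_measurable borel" by (rule borel_measurable_continuous_onI)
    from measurable_sets_borel[OF this X] show ?thesis by (simp add: sets)
  qed
  have exp_large: "\<forall>\<^sub>F n in sequentially. C \<le> exp (real n * c)" if "0 < c" for C c :: real
  proof -
    have "filterlim (\<lambda>n. exp (real n * c)) at_top sequentially"
      by (rule filterlim_compose[OF exp_at_top])
        (use that in \<open>intro filterlim_at_top_mult_tendsto_pos[OF tendsto_const] filterlim_real_sequentially\<close>)
    then show ?thesis by (simp add: filterlim_at_top)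
  qed
  have lower: "\<forall>\<^sub>F k in sequentially. 1 - \<eta> < prob (?X (k * N))" if "0 < \<eta>" "\<eta> < 1" for \<eta>
  proof -
    \<comment> \<open>Any centre will do, since the balls of integer radius about it exhaust the
      space.\<close>
    fix x0 :: 'a
    have "(\<lambda>R. prob (ball x0 (real R))) \<longlonglongrightarrow> prob (\<Union>R. ball x0 (real R))"
      by (intro finite_Lim_measure_incseq) (auto simp: sets incseq_def)
    moreover have "(\<Union>R. ball x0 (real R)) = space \<mu>"
      using sets_eq_imp_space_eq[OF sets] reals_Archimedean2 by auto
    ultimately have "\<forall>\<^sub>F R in sequentially. 1 - \<eta> < prob (ball x0 (real R))"
      using that by (intro order_tendstoD(1)[of _ 1]) (auto simp: prob_space)
    then obtain R where R: "1 - \<eta> < prob (ball x0 (real R))"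
      by (auto simp: eventually_sequentially)
    define m where "m = prob (ball x0 (real R))"
    have m: "0 < m" using R that by (simp add: m_def)
    have bound: "\<forall>\<^sub>F n in sequentially.
        m * (1 - word_expectation p n (\<lambda>w. of_bool (?few n w)) - word_expectation p n (\<lambda>w. of_bool (?far n w)))
        \<le> prob (?X n)"
      using exp_large[of "a - a'" "2 * real R", OF diff_gt_0_iff_gt[THEN iffD2, OF a'(2)]]
        exp_large[of "b - b'" "1 / m", OF diff_gt_0_iff_gt[THEN iffD2, OF b'(2)]]
    proof eventually_elim
      case (elim n)
      have s: "exp (real n * a') * (2 * real R) \<le> exp (real n * a)"
        using elim(1) by (simp add: right_diff_distrib exp_diff field_simps)
      have c: "exp (- (real n * b)) \<le> exp (- (real n * b')) * m"
        using elim(2) m by (simp add: right_diff_distrib exp_diff exp_minus field_simps)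
      \<comment> \<open>Union bound in pointwise form: the integrand is \<open>m\<close> on good
        words and at most \<open>0\<close> on the others.\<close>
      have "m * (1 - word_expectation p n (\<lambda>w. of_bool (?few n w)) - word_expectation p n (\<lambda>w. of_bool (?far n w)))
          = word_expectation p n (\<lambda>w. m * (1 + ((- 1) * of_bool (?few n w) + (- 1) * of_bool (?far n w))))"
        by (simp only: word_expectation_cmult word_expectation_plus word_expectation_const) simp
      also have "\<dots> \<le> word_expectation p n (\<lambda>w. prob (word_map f w -` ?X n))"
      proof (rule word_expectation_mono)
        fix w :: "'m list"
        show "m * (1 + ((- 1) * of_bool (?few n w) + (- 1) * of_bool (?far n w)))
            \<le> prob (word_map f w -` ?X n)"
        proof (cases "?few n w \<or> ?far n w")
          case True
          then have "m * (1 + ((- 1) * of_bool (?few n w) + (- 1) * of_bool (?far n w))) \<le> 0"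
            using m by auto
          then show ?thesis by (rule order_trans) simp
        next
          case False
          have "ball x0 (real R) \<subseteq> word_map f w -` ?X n"
          proof
            fix y assume y: "y \<in> ball x0 (real R)"
            have "exp (- (real n * b)) \<le> fibre_prob p f w * m"
              using c False m by (smt (verit) mult_right_mono)
            then have "exp (- (real n * b)) \<le> prob (ball (word_map f w y) (exp (real n * a)))"
              using False unfolding m_def
              by (intro good_word_image[OF lip stat _ s _ y]) auto
            then show "y \<in> word_map f w -` ?X n" by simp
          qed
          then show ?thesis
            using False finite_measure_mono[OF _ preX] by (simp add: m_def)
        qed
      qed
      also have "\<dots> = prob (?X n)"
        by (rule stationary_measure_words[OF lip stat X, symmetric])
      finally show ?case .
    qed
    \<comment> \<open>Both failure probabilities vanish along the multiples of \<open>N\<close>, so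
      the lower bound tends to \<open>m\<close>, which exceeds \<open>1 - \<eta>\<close>.\<close>
    have "(\<lambda>k. m * (1 - word_expectation p (k * N) (\<lambda>w. of_bool (?few (k * N) w))
        - word_expectation p (k * N) (\<lambda>w. of_bool (?far (k * N) w)))) \<longlonglongrightarrow> m * (1 - 0 - 0)"
      by (intro tendsto_intros few far)
    then have "\<forall>\<^sub>F k in sequentially. 1 - \<eta> <
        m * (1 - word_expectation p (k * N) (\<lambda>w. of_bool (?few (k * N) w))
        - word_expectation p (k * N) (\<lambda>w. of_bool (?far (k * N) w)))"
      using R by (intro order_tendstoD(1)) (auto simp: m_def)
    with eventually_compose_filterlim[OF bound kN] show ?thesis
      by eventually_elim simp
  qed
  have "(\<lambda>k. prob (?X (k * N))) \<longlonglongrightarrow> 1"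
  proof (rule order_tendstoI)
    fix y :: real assume "y < 1"
    then obtain y' where "max 0 y < y'" "y' < 1" using dense[of "max 0 y" 1] by auto
    then show "\<forall>\<^sub>F k in sequentially. y < prob (?X (k * N))"
      using lower[of "1 - y'"] by (auto elim: eventually_mono)
  next
    fix y :: real assume "1 < y"
    then show "\<forall>\<^sub>F k in sequentially. prob (?X (k * N)) < y"
      by (intro always_eventually allI) (rule le_less_trans[OF prob_le_1])
  qed
  then show thesis using that N by blast
qed

lemma AE_lower_local_dim_le:
  fixes p :: "'m::finite pmf" and f :: "'m \<Rightarrow> 'a::{metric_space,second_countable_topology} \<Rightarrow> 'a"
  assumes lip: "\<And>i. lipschitz_map (f i)" and contr: "contracts_on_average p f chi"
    and stat: "stationary_measure p f \<mu>"
    and a: "chi < a" "a < 0" and b: "walk_entropy p f * ln (growth_rate f) < b"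
  shows "AE x in \<mu>. lower_local_dim \<mu> x \<le> ereal (b / - a)"
proof -
  interpret prob_space \<mu> using stat by (simp add: stationary_measure_def)
  have sets: "sets \<mu> = sets borel" using stat by (simp add: stationary_measure_def)
  let ?X = "\<lambda>n. {x. exp (- (real n * b)) \<le> measure \<mu> (ball x (exp (real n * a)))}"
  obtain N where N: "N > 0" and lim: "(\<lambda>k. prob (?X (k * N))) \<longlonglongrightarrow> 1"
    using large_ball_measure_LIMSEQ[OF lip contr stat a(1) b] by blast
  have "?X n \<in> events" for n
    unfolding sets
    using borel_measurable_measure_ball[OF prob_space_axioms sets, measurable] by measurable
  then have "AE x in \<mu>. \<exists>\<^sub>F k in sequentially. x \<in> ?X (k * N)"
    using lim by (rule AE_frequently_if_prob_LIMSEQ_1)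
  then show ?thesis
  proof eventually_elim
    case (elim x)
    have "filterlim (\<lambda>k. k * N) sequentially sequentially"
      using N by (intro filterlim_subseq strict_monoI) simp
    then have "\<exists>\<^sub>F n in sequentially. x \<in> ?X n"
      using elim eventually_compose_filterlim unfolding frequently_def by blast
    then show ?case using a by (intro lower_local_dim_le) auto
  qed
qed

theorem theorem2p2:
  fixes f :: "'m::finite \<Rightarrow> real ^ 'd \<Rightarrow> real ^ 'd"
    and p :: "'m pmf"
    and chi :: real
    and \<mu> :: "(real ^ 'd) measure"
  assumes "\<And>i. lipschitz_map (f i)"
    and "contracts_on_average p f chi"
    and "stationary_measure p f \<mu>"
  shows "measure_hausdorff_dim \<mu> \<le> ereal (- (walk_entropy p f * ln (growth_rate f)) / chi)"
proof -
  define h where "h = walk_entropy p f * ln (growth_rate f)"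
  have chi: "chi < 0" using assms(2) by (simp add: contracts_on_average_def)
  have meas: "lower_local_dim \<mu> \<in> borel_measurable \<mu>"
    using assms(3) by (intro borel_measurable_lower_local_dim) (auto simp: stationary_measure_def)
  \<comment> \<open>The shift by \<open>2\<close> gives
    \<open>chi + e n = chi * (n + 1) / (n + 2)\<close>, which is negative for every
    \<open>n\<close>, including \<open>0\<close>.\<close>
  define e where "e n = - chi / real (n + 2)" for n
  have e: "0 < e n" "chi + e n < 0" for n
    using chi by (auto simp: e_def field_simps intro!: add_neg_nonpos mult_nonpos_nonneg)
  \<comment> \<open>Reindexing makes the sequence equal to \<open>- chi / n\<close> from
    \<open>n = 2\<close> on, where the truncated subtraction is exact.\<close>
  have "(\<lambda>n. e (n - 2)) \<longlonglongrightarrow> 0"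
  proof (rule Lim_transform_eventually[OF lim_const_over_n[of "- chi"]])
    show "\<forall>\<^sub>F n in sequentially. - chi / real n = e (n - 2)"
      using eventually_ge_at_top[of 2] by eventually_elim (simp add: e_def)
  qed
  then have lim: "(\<lambda>n. ereal ((h + e (n - 2)) / - (chi + e (n - 2)))) \<longlonglongrightarrow> ereal ((h + 0) / - (chi + 0))"
    using chi by (intro tendsto_intros) auto
  \<comment> \<open>The almost everywhere bound is taken at \<open>a = chi + e n\<close> and
    \<open>b = h + e n\<close>; letting \<open>n\<close> grow removes the margins.\<close>
  have "measure_hausdorff_dim \<mu> \<le> ereal ((h + e n) / - (chi + e n))" for n
    unfolding measure_hausdorff_dim_def using e[of n]
    by (intro esssup_I meas AE_lower_local_dim_le[OF assms]) (auto simp: h_def)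
  then have "measure_hausdorff_dim \<mu> \<le> ereal ((h + 0) / - (chi + 0))"
    by (intro LIMSEQ_le_const[OF lim]) blast
  then show ?thesis by (simp add: h_def)
qed

end
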